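(* Let $G_1,G_2$ be domains in $\mathbb R^n$ with $G_1\cap G_2\ne\emptyset$, $G_1\ne\mathbb R^n\ne G_2$, let $G=G_1\cup G_2$, and assume that there exists $c\in(0,1)$ such that $$d(x,\partial G_1)+d(x,\partial G_2)\ge c\,d(x,\partial(G_1\cup G_2))\qquad\text{for all }x\in G.$$ Suppose that $f:G\to fG\subseteq\mathbb R^n$ is continuous, that $\{m_D: D\subseteq\mathbb R^n\}$ is a monotone family of metrics, and that for $i=1,2$ there is an increasing function $\omega_i:[0,\infty)\to[0,\infty)$ with $$m_{fG_i}(f(x),f(y))\le\omega_i(j_{G_i}(x,y))\qquad\text{for all }x,y\in G_i.$$ Let $\delta=\log\left(1+\frac c4\right)$. Then there exists $\omega:[0,\delta]\to[0,\infty)$ such that $$m_{fG}(f(x),f(y))\le\omega(j_G(x,y))$$ for all $x,y\in G$ with $j_G(x,y)\le\delta$, and $\lim_{t\to0+}\omega(t)=0$ provided $\lim_{t\to0+}\omega_i(t)=0$ for $i=1,2$.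
   Context: $d(x,A)$ is the Euclidean distance from $x$ to $A$. For an open set $G\subset\mathbb R^n$, $G\neq\mathbb R^n$, the distance ratio metric is $$j_G(x,y)=\log\left(1+\frac{|x-y|}{\min\{d(x,\partial G),d(y,\partial G)\}}\right),\quad x,y\in G.$$ A family of metrics $\{m_D\}$ ($m_D$ a metric on $D$) is called monotone if $D_1\subseteq D_2$ implies $m_{D_1}(x,y)\ge m_{D_2}(x,y)$ for all $x,y\in D_1$. It is implicit that $G\ne\mathbb R^n$, so that $j_G$ and $d(x,\partial G)$ are defined. *)

theory Defs
  imports "HOL-Analysis.Analysis"
begin

text \<open>
  Meaningful for open \<open>G\<close> with \<open>G \<noteq> {}\<close> and \<open>G \<noteq> UNIV\<close>: then the frontier is
  nonempty, so \<^const>\<open>infdist\<close> is the true distance to it, and the denominator is positive for \<open>x, y \<in> G\<close>.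
\<close>
definition distance_ratio :: "(real ^ 'n) set \<Rightarrow> real ^ 'n \<Rightarrow> real ^ 'n \<Rightarrow> real" where
  "distance_ratio G x y =
     ln (1 + norm (x - y) / min (infdist x (frontier G)) (infdist y (frontier G)))"

text \<open>
  The collection \<open>\<D>\<close> consists of the sets \<open>D\<close> for which the metric \<open>m D\<close> is given.
  It is explicit because typical families (such as the distance ratio metrics) exist only for
  certain sets; \<open>\<D> = UNIV\<close> is the case of a metric on every subset.
  The values of \<open>m D\<close> outside \<open>D\<close> carry no information: \<^const>\<open>Metric_space\<close> requires
  nonnegativity and symmetry there too, which the value 0 satisfies.
\<close>
definition monotone_metric_family ::
    "'a set set \<Rightarrow> ('a set \<Rightarrow> 'a \<Rightarrow> 'a \<Rightarrow> real) \<Rightarrow> bool" where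
  "monotone_metric_family \<D> m \<longleftrightarrow>
     (\<forall>D\<in>\<D>. Metric_space D (m D)) \<and>
     (\<forall>D1\<in>\<D>. \<forall>D2\<in>\<D>. D1 \<subseteq> D2 \<longrightarrow> (\<forall>x\<in>D1. \<forall>y\<in>D1. m D1 x y \<ge> m D2 x y))"

end

theory Submission
  imports Defs
begin

text \<open>
  Every \<open>x \<in> G\<close> lies in one of the \<open>G\<^sub>i\<close> with \<open>d(x, \<partial>G\<^sub>i) \<ge> (c/2) d(x, \<partial>G)\<close>.
  If \<open>j\<^sub>G(x, y) \<le> log (1 + c/4)\<close>, then \<open>\<bar>x - y\<bar> \<le> (c/4) d(x, \<partial>G) \<le> d(x, \<partial>G\<^sub>i)/2\<close>, so
  \<open>y\<close> lies in the same \<open>G\<^sub>i\<close> and both boundary distances in \<open>G\<^sub>i\<close> are at least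
  \<open>(c/4) d(x, \<partial>G)\<close>. Hence \<open>j\<^bsub>G\<^sub>i\<^esub>(x, y) \<le> log (1 + (4/c) (exp (j\<^sub>G(x, y)) - 1))\<close>,
  and by monotonicity of the family one may take for \<open>\<omega>\<close> the maximum of the \<open>\<omega>\<^sub>i\<close>
  composed with this change of scale.
\<close>

text \<open>The segment from \<open>x\<close> to \<open>y\<close> joins a point of \<open>A\<close>
  to a point outside, so it meets the frontier, no farther from \<open>x\<close> than
  \<open>y\<close> is. Read contrapositively, this keeps points close to \<open>x\<close> inside
  \<open>A\<close>.\<close>

lemma infdist_frontier_le_dist:
  fixes x y :: "'a::euclidean_space"
  assumes "x \<in> A" "y \<notin> A"
  shows "infdist x (frontier A) \<le> dist x y"
proof -
  have "closed_segment x y \<inter> frontier A \<noteq> {}"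
    using assms by (intro connected_Int_frontier) auto
  then obtain w where w: "w \<in> closed_segment x y" "w \<in> frontier A"
    by blast
  have "infdist x (frontier A) \<le> dist x w"
    using w(2) by (rule infdist_le)
  also have "\<dots> \<le> dist x y"
    using dist_in_closed_segment[OF w(1)] by (simp add: dist_commute)
  finally show ?thesis .
qed

lemma frontier_nonempty:
  fixes A :: "'a::real_normed_vector set"
  assumes "A \<noteq> {}" "A \<noteq> UNIV"
  shows "frontier A \<noteq> {}"
  using assms frontier_eq_empty by blast

lemma infdist_frontier_pos:
  fixes x :: "'a::real_normed_vector"
  assumes "open A" "A \<noteq> UNIV" "x \<in> A"
  shows "0 < infdist x (frontier A)"
proof -
  have "x \<notin> frontier A"
    using assms by (simp add: frontier_def interior_open)
  moreover have "frontier A \<noteq> {}"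
    using assms by (intro frontier_nonempty) auto
  ultimately show ?thesis
    by (metis frontier_closed in_closed_iff_infdist_zero infdist_nonneg less_eq_real_def)
qed

text \<open>A boundary point of \<open>A\<close> nearest to \<open>x\<close> lies either outside \<open>A \<union> B\<close> or in \<open>B\<close>; in
  the second case the segment from \<open>x\<close> to it meets the boundary of \<open>B\<close>.\<close>
lemma infdist_frontier_ge_outside:
  fixes x :: "'a::euclidean_space"
  assumes "open A" "A \<noteq> UNIV" "x \<in> A" "x \<notin> B"
  shows "min (infdist x (frontier B)) (infdist x (frontier (A \<union> B))) \<le> infdist x (frontier A)"
proof -
  have "frontier A \<noteq> {}"
    using assms by (intro frontier_nonempty) auto
  then obtain z where z: "z \<in> frontier A" "infdist x (frontier A) = dist x z"
    using infdist_attains_inf[OF frontier_closed] by blast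
  have "z \<notin> A"
    using z(1) \<open>open A\<close> by (simp add: frontier_def interior_open)
  show ?thesis
  proof (cases "z \<in> B")
    case True
    \<comment> \<open>The set \<open>- B\<close> contains \<open>x\<close> but not \<open>z\<close>
      and has the same frontier as \<open>B\<close>.\<close>
    then have "infdist x (frontier B) \<le> dist x z"
      using infdist_frontier_le_dist[of x "- B" z] \<open>x \<notin> B\<close> by (simp add: frontier_complement)
    then show ?thesis
      using z(2) by simp
  next
    case False
    then have "infdist x (frontier (A \<union> B)) \<le> dist x z"
      using \<open>z \<notin> A\<close> \<open>x \<in> A\<close> by (intro infdist_frontier_le_dist) auto
    then show ?thesis
      using z(2) by simp
  qed
qed

text \<open>For \<open>x\<close> in both sets, the larger of the two distances is at least half
  their sum. For \<open>x\<close> in \<open>A\<close> only, the preceding lemma leaves two cases: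
  either the distance to the frontier of \<open>A\<close> is again the larger one, or it is at least
  the distance to the frontier of the union, and then \<open>c / 2 \<le> 1\<close> suffices.\<close>

lemma infdist_frontier_union_cases:
  fixes A B :: "'a::euclidean_space set"
  assumes "open A" "A \<noteq> UNIV" "open B" "B \<noteq> UNIV" "x \<in> A \<union> B" "c \<le> 2"
    and sum: "c * infdist x (frontier (A \<union> B)) \<le> infdist x (frontier A) + infdist x (frontier B)"
  shows "x \<in> A \<and> c / 2 * infdist x (frontier (A \<union> B)) \<le> infdist x (frontier A) \<or>
         x \<in> B \<and> c / 2 * infdist x (frontier (A \<union> B)) \<le> infdist x (frontier B)"
proof -
  define a b g where "a = infdist x (frontier A)" "b = infdist x (frontier B)"
    "g = infdist x (frontier (A \<union> B))"
  note d = this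
  have "c / 2 * g \<le> 1 * g"
    using \<open>c \<le> 2\<close> by (intro mult_right_mono) (auto simp: d infdist_nonneg)
  moreover have "min b g \<le> a" if "x \<in> A" "x \<notin> B"
    using infdist_frontier_ge_outside[of A x B] assms that by (simp add: d)
  moreover have "min a g \<le> b" if "x \<in> B" "x \<notin> A"
    using infdist_frontier_ge_outside[of B x A] assms that by (simp add: d Un_commute)
  moreover have "c * g \<le> a + b"
    using sum by (simp add: d)
  ultimately show ?thesis
    using \<open>x \<in> A \<union> B\<close> unfolding d[symmetric]
    by (cases "x \<in> A"; cases "x \<in> B"; simp add: min_le_iff_disj; linarith)
qed

lemma distance_ratio_nonneg: "0 \<le> distance_ratio G x y"
  unfolding distance_ratio_def
  by (intro ln_ge_zero) (auto intro!: divide_nonneg_nonneg simp: infdist_nonneg)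

lemma exp_distance_ratio:
  "exp (distance_ratio G x y) =
     1 + norm (x - y) / min (infdist x (frontier G)) (infdist y (frontier G))"
proof -
  \<comment> \<open>A zero denominator gives the quotient 0, so \<open>ln\<close> is always applied
    to a number that is at least 1.\<close>
  have "0 \<le> norm (x - y) / min (infdist x (frontier G)) (infdist y (frontier G))"
    by (intro divide_nonneg_nonneg) (auto simp: infdist_nonneg)
  then show ?thesis
    by (simp add: distance_ratio_def)
qed

text \<open>Let \<open>\<mu>\<close> be the denominator in \<open>distance_ratio G x y\<close>. The
  step from \<open>x\<close> to \<open>y\<close> has length at most \<open>c / 4 * \<mu>\<close>, at
  most half of the margin \<open>c / 2 * \<mu>\<close> that \<open>x\<close> has in
  \<open>A\<close>. So \<open>y\<close> stays in \<open>A\<close> with margin at least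
  \<open>c / 4 * \<mu>\<close>, and passing from \<open>\<mu>\<close> to this denominator costs the
  factor \<open>4 / c\<close>.\<close>

lemma distance_ratio_le_of_infdist_frontier:
  assumes A: "x \<in> A" and g: "0 < infdist x (frontier G)" "0 < infdist y (frontier G)"
    and c: "0 < c" "c / 2 * infdist x (frontier G) \<le> infdist x (frontier A)"
    and le: "distance_ratio G x y \<le> ln (1 + c / 4)"
  shows "y \<in> A" and "distance_ratio A x y \<le> ln (1 + 4 / c * (exp (distance_ratio G x y) - 1))"
proof -
  define \<mu> where "\<mu> = min (infdist x (frontier G)) (infdist y (frontier G))"
  have "0 < \<mu>" "\<mu> \<le> infdist x (frontier G)"
    using g by (auto simp: \<mu>_def)
  have e: "exp (distance_ratio G x y) - 1 = norm (x - y) / \<mu>"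
    by (simp add: exp_distance_ratio \<mu>_def)
  have "exp (distance_ratio G x y) \<le> 1 + c / 4"
    using le c(1) by (metis add_pos_pos divide_pos_pos exp_le_cancel_iff exp_ln zero_less_numeral zero_less_one)
  then have "norm (x - y) / \<mu> \<le> c / 4"
    using e by linarith
  then have n: "norm (x - y) \<le> c / 4 * \<mu>"
    using \<open>0 < \<mu>\<close> pos_divide_le_eq by blast
  have p: "c / 2 * \<mu> \<le> infdist x (frontier A)"
    using mult_left_mono[OF \<open>\<mu> \<le> infdist x (frontier G)\<close>, of "c / 2"] c by linarith
  have "0 < c / 4 * \<mu>"
    using \<open>0 < \<mu>\<close> c by simp
  then have lt: "dist x y < infdist x (frontier A)"
    using n p by (simp add: dist_norm)
  show "y \<in> A"
    using infdist_frontier_le_dist[OF \<open>x \<in> A\<close>, of y] lt by fastforce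
  have "infdist x (frontier A) \<le> infdist y (frontier A) + dist x y"
    by (rule infdist_triangle)
  then have q: "c / 4 * \<mu> \<le> infdist y (frontier A)"
    using n p by (simp add: dist_norm)
  have "c / 4 * \<mu> \<le> min (infdist x (frontier A)) (infdist y (frontier A))"
    using p q \<open>0 < c / 4 * \<mu>\<close> by simp
  then have "norm (x - y) / min (infdist x (frontier A)) (infdist y (frontier A)) \<le> norm (x - y) / (c / 4 * \<mu>)"
    using \<open>0 < c / 4 * \<mu>\<close> by (intro frac_le) (auto simp del: min.bounded_iff)
  also have "\<dots> = 4 / c * (norm (x - y) / \<mu>)"
    by simp
  finally have "exp (distance_ratio A x y) \<le> 1 + 4 / c * (exp (distance_ratio G x y) - 1)"
    unfolding exp_distance_ratio[of A] e by simp
  then show "distance_ratio A x y \<le> ln (1 + 4 / c * (exp (distance_ratio G x y) - 1))"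
    using ln_mono[OF _ exp_gt_zero] by fastforce
qed

theorem lemma6p6:
  fixes G1 G2 G :: "(real ^ 'n) set"
    and f :: "real ^ 'n \<Rightarrow> real ^ 'n"
    and \<D> :: "(real ^ 'n) set set"
    and m :: "(real ^ 'n) set \<Rightarrow> real ^ 'n \<Rightarrow> real ^ 'n \<Rightarrow> real"
    and \<omega>1 \<omega>2 :: "real \<Rightarrow> real"
    and c \<delta> :: real
  assumes "open G1" and "connected G1" and "open G2" and "connected G2"
    and "G1 \<inter> G2 \<noteq> {}"
    and "G1 \<noteq> UNIV" and "G2 \<noteq> UNIV"
    and "G = G1 \<union> G2" and "G \<noteq> UNIV"
    and "0 < c" and "c < 1"
    and "\<forall>x\<in>G. infdist x (frontier G1) + infdist x (frontier G2) \<ge> c * infdist x (frontier G)"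
    and "continuous_on G f"
    and "monotone_metric_family \<D> m"
    and "f ` G1 \<in> \<D>" and "f ` G2 \<in> \<D>" and "f ` G \<in> \<D>"
    and "mono_on {0..} \<omega>1" and "\<forall>t\<ge>0. \<omega>1 t \<ge> 0"
    and "mono_on {0..} \<omega>2" and "\<forall>t\<ge>0. \<omega>2 t \<ge> 0"
    and "\<forall>x\<in>G1. \<forall>y\<in>G1. m (f ` G1) (f x) (f y) \<le> \<omega>1 (distance_ratio G1 x y)"
    and "\<forall>x\<in>G2. \<forall>y\<in>G2. m (f ` G2) (f x) (f y) \<le> \<omega>2 (distance_ratio G2 x y)"
    and "\<delta> = ln (1 + c / 4)"
  shows "\<exists>\<omega> :: real \<Rightarrow> real.
    (\<forall>t\<in>{0..\<delta>}. \<omega> t \<ge> 0) \<and>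
    (\<forall>x\<in>G. \<forall>y\<in>G. distance_ratio G x y \<le> \<delta> \<longrightarrow>
       m (f ` G) (f x) (f y) \<le> \<omega> (distance_ratio G x y)) \<and>
    ((\<omega>1 \<longlongrightarrow> 0) (at_right 0) \<and> (\<omega>2 \<longlongrightarrow> 0) (at_right 0) \<longrightarrow> (\<omega> \<longlongrightarrow> 0) (at_right 0))"
proof -
  \<comment> \<open>The quotient inside the logarithm is \<open>exp t - 1\<close>; \<open>s\<close>
    multiplies it by \<open>4 / c\<close>.\<close>
  define s where "s t = ln (1 + 4 / c * (exp t - 1))" for t :: real
  \<comment> \<open>The maximum covers both cases, since the piece containing \<open>x\<close> and
    \<open>y\<close> depends on the pair.\<close>
  define \<omega> where "\<omega> t = max (\<omega>1 (s t)) (\<omega>2 (s t))" for t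
  have s_nonneg: "0 \<le> s t" if "0 \<le> t" for t
    unfolding s_def using that \<open>0 < c\<close> by (intro ln_ge_zero) simp
  have piece: "m (f ` G) (f x) (f y) \<le> \<omega>i (s (distance_ratio G x y))"
    if H: "H \<subseteq> G" "f ` H \<in> \<D>" "mono_on {0..} \<omega>i"
      and bound: "\<forall>x\<in>H. \<forall>y\<in>H. m (f ` H) (f x) (f y) \<le> \<omega>i (distance_ratio H x y)"
      and xy: "x \<in> H" "y \<in> G" "distance_ratio G x y \<le> \<delta>"
      and d: "c / 2 * infdist x (frontier G) \<le> infdist x (frontier H)"
    for H \<omega>i x y
  proof -
    have "open G"
      using \<open>open G1\<close> \<open>open G2\<close> \<open>G = G1 \<union> G2\<close> by auto
    then have "0 < infdist x (frontier G)" "0 < infdist y (frontier G)"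
      using H xy \<open>G \<noteq> UNIV\<close> by (auto intro!: infdist_frontier_pos)
    from distance_ratio_le_of_infdist_frontier[OF \<open>x \<in> H\<close> this \<open>0 < c\<close> d] xy(3)
    have "y \<in> H" and le: "distance_ratio H x y \<le> s (distance_ratio G x y)"
      using \<open>\<delta> = ln (1 + c / 4)\<close> by (auto simp: s_def)
    \<comment> \<open>Since \<open>f\<close> H\<open>is a subset of\<close>f \<open>G\<close>, the
      metric of the larger image is the smaller one.\<close>
    have "m (f ` G) (f x) (f y) \<le> m (f ` H) (f x) (f y)"
      using \<open>monotone_metric_family \<D> m\<close> \<open>f ` G \<in> \<D>\<close> H(1,2) \<open>x \<in> H\<close> \<open>y \<in> H\<close>
      unfolding monotone_metric_family_def by (meson image_eqI image_mono)
    also have "\<dots> \<le> \<omega>i (distance_ratio H x y)"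
      using bound \<open>x \<in> H\<close> \<open>y \<in> H\<close> by blast
    also have "\<dots> \<le> \<omega>i (s (distance_ratio G x y))"
      using distance_ratio_nonneg le by (intro mono_onD[OF H(3)]) (auto intro: order_trans)
    finally show ?thesis .
  qed
  show ?thesis
  proof (intro exI conjI ballI impI)
    show "0 \<le> \<omega> t" if "t \<in> {0..\<delta>}" for t
      using s_nonneg[of t] that \<open>\<forall>t\<ge>0. \<omega>1 t \<ge> 0\<close> by (auto simp: \<omega>_def le_max_iff_disj)
  next
    fix x y
    assume xy: "x \<in> G" "y \<in> G" "distance_ratio G x y \<le> \<delta>"
    have "x \<in> G1 \<and> c / 2 * infdist x (frontier G) \<le> infdist x (frontier G1) \<or>
          x \<in> G2 \<and> c / 2 * infdist x (frontier G) \<le> infdist x (frontier G2)"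
      using infdist_frontier_union_cases[of G1 G2 x c] assms xy(1) by auto
    then show "m (f ` G) (f x) (f y) \<le> \<omega> (distance_ratio G x y)"
    proof (elim disjE conjE)
      assume "x \<in> G1" "c / 2 * infdist x (frontier G) \<le> infdist x (frontier G1)"
      with assms xy have "m (f ` G) (f x) (f y) \<le> \<omega>1 (s (distance_ratio G x y))"
        by (intro piece[of G1]) simp_all
      then show ?thesis
        by (simp add: \<omega>_def)
    next
      assume "x \<in> G2" "c / 2 * infdist x (frontier G) \<le> infdist x (frontier G2)"
      with assms xy have "m (f ` G) (f x) (f y) \<le> \<omega>2 (s (distance_ratio G x y))"
        by (intro piece[of G2]) simp_all
      then show ?thesis
        by (simp add: \<omega>_def)
    qed
  next
    assume lim: "(\<omega>1 \<longlongrightarrow> 0) (at_right 0) \<and> (\<omega>2 \<longlongrightarrow> 0) (at_right 0)"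
    have "(s \<longlongrightarrow> ln (1 + 4 / c * (exp 0 - 1))) (at_right 0)"
      unfolding s_def by (intro tendsto_intros) simp
    \<comment> \<open>The limits of \<open>\<omega>1\<close> and \<open>\<omega>2\<close> are
      one-sided and say nothing about their values at 0, so \<open>s\<close> has to approach 0
      through positive values.\<close>
    moreover have "\<forall>\<^sub>F t in at_right 0. 0 < s t"
    proof (rule eventually_at_right_less[THEN eventually_mono])
      show "0 < s t" if "0 < t" for t
        unfolding s_def using that \<open>0 < c\<close> by (intro ln_gt_zero) simp
    qed
    ultimately have "filterlim s (at_right 0) (at_right 0)"
      by (intro tendsto_imp_filterlim_at_right) auto
    then have "((\<lambda>t. \<omega>1 (s t)) \<longlongrightarrow> 0) (at_right 0)" "((\<lambda>t. \<omega>2 (s t)) \<longlongrightarrow> 0) (at_right 0)"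
      using lim filterlim_compose by blast+
    then have "((\<lambda>t. max (\<omega>1 (s t)) (\<omega>2 (s t))) \<longlongrightarrow> max 0 0) (at_right 0)"
      by (rule tendsto_max)
    then show "(\<omega> \<longlongrightarrow> 0) (at_right 0)"
      by (simp add: \<omega>_def[abs_def])
  qed
qed

end
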